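(* Let $G$ be a graph and $F$ a set of nonedges of $G$ such that $G\cup F$ is a partial $3$-tree. Then $(G,F)$ has the $3$-covering map property: for every $\ell:E(G)\to\mathbb{R}_{\ge0}$, the image under the Cayley map $\phi_F$ of every connected component of $\mathcal{C}^3(G,\ell)$ equals $\Omega^3_F(G,\ell)$.
   Context: A linkage $(G,\ell)$: finite simple graph $G$ and $\ell:E(G)\to\mathbb{R}_{\ge0}$ (squared lengths). A $3$-realization is $p:V(G)\to\mathbb{R}^3$ with $\|p(x)-p(y)\|^2=\ell(xy)$ for all $xy\in E(G)$; $\mathcal{C}^3(G,\ell)\subseteq(\mathbb{R}^3)^{V(G)}$ is the set of these (with the subspace topology). For an indexed set $F=\{u_1v_1,\dots,u_mv_m\}$ of nonedges, $\phi_F(p)=(\|p(u_i)-p(v_i)\|^2)_{i}$ and $\Omega^3_F(G,\ell)=\phi_F(\mathcal{C}^3(G,\ell))$. $G\cup F$ is $G$ with the pairs of $F$ added as edges. A $3$-tree is $K_4$ or is obtained from a $3$-tree by adding a new vertex adjacent to exactly the three vertices of some triangle; a partial $3$-tree is a subgraph of a $3$-tree. *)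

theory Defs
  imports "HOL-Analysis.Analysis"
begin

definition simple_graph :: "'a set \<Rightarrow> 'a set set \<Rightarrow> bool" where
  "simple_graph V E \<longleftrightarrow> finite V \<and> (\<forall>e\<in>E. e \<subseteq> V \<and> card e = 2)"

inductive three_tree :: "nat set \<Rightarrow> nat set set \<Rightarrow> bool" where
  K4: "card V = 4 \<Longrightarrow> E = {e. e \<subseteq> V \<and> card e = 2} \<Longrightarrow> three_tree V E"
| add: "three_tree V E \<Longrightarrow> a \<in> V \<Longrightarrow> b \<in> V \<Longrightarrow> c \<in> V \<Longrightarrow>
        a \<noteq> b \<Longrightarrow> b \<noteq> c \<Longrightarrow> a \<noteq> c \<Longrightarrow>
        {a,b} \<in> E \<Longrightarrow> {b,c} \<in> E \<Longrightarrow> {a,c} \<in> E \<Longrightarrow> v \<notin> V \<Longrightarrow>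
        three_tree (insert v V) (E \<union> {{v,a},{v,b},{v,c}})"

definition partial_three_tree :: "'a set \<Rightarrow> 'a set set \<Rightarrow> bool" where
  "partial_three_tree V E \<longleftrightarrow>
     (\<exists>TV TE f. three_tree TV TE \<and> inj_on f V \<and> f ` V \<subseteq> TV \<and> (\<forall>e\<in>E. f ` e \<in> TE))"

definition nonedges :: "'a set \<Rightarrow> 'a set set \<Rightarrow> ('a \<times> 'a) list \<Rightarrow> bool" where
  "nonedges V E F \<longleftrightarrow>
     (\<forall>(u,v)\<in>set F. u \<in> V \<and> v \<in> V \<and> u \<noteq> v \<and> {u,v} \<notin> E)
     \<and> distinct (map (\<lambda>(u,v). {u,v}) F)"

definition graph_union :: "'a set set \<Rightarrow> ('a \<times> 'a) list \<Rightarrow> 'a set set" where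
  "graph_union E F = E \<union> (\<lambda>(u,v). {u,v}) ` set F"

text \<open>Space of 3-realizations: maps V \<rightarrow> R^3 (extended by 0 off V, so that the
  product topology on 'a \<Rightarrow> real^3 restricts to the topology of (R^3)^V).\<close>
definition config3 :: "'a set \<Rightarrow> 'a set set \<Rightarrow> ('a set \<Rightarrow> real) \<Rightarrow> ('a \<Rightarrow> real^3) set" where
  "config3 V E l = {p. (\<forall>x. x \<notin> V \<longrightarrow> p x = 0) \<and>
      (\<forall>e\<in>E. \<forall>x y. e = {x,y} \<longrightarrow> (norm (p x - p y))^2 = l e)}"

definition cayley_map :: "('a \<times> 'a) list \<Rightarrow> ('a \<Rightarrow> real^3) \<Rightarrow> real list" where
  "cayley_map F p = map (\<lambda>(u,v). (norm (p u - p v))^2) F"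

definition Omega3 :: "'a set \<Rightarrow> 'a set set \<Rightarrow> ('a set \<Rightarrow> real) \<Rightarrow> ('a \<times> 'a) list \<Rightarrow> real list set" where
  "Omega3 V E l F = cayley_map F ` config3 V E l"

definition covering_map_property3 :: "'a set \<Rightarrow> 'a set set \<Rightarrow> ('a \<times> 'a) list \<Rightarrow> bool" where
  "covering_map_property3 V E F \<longleftrightarrow>
     (\<forall>l. (\<forall>e\<in>E. l e \<ge> 0) \<longrightarrow>
        (\<forall>p\<in>config3 V E l.
           cayley_map F ` connected_component_set (config3 V E l) p = Omega3 V E l F))"

end

theory Submission
  imports Defs
begin

text \<open>
  Let \<open>p\<close> and \<open>q\<close> realize a 3-tree containing \<open>G \<union> F\<close>. The configurations \<open>(\<surd>(1 - t) p, \<surd>t q)\<close> in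
  six-dimensional space interpolate the squared lengths linearly, so edges on which \<open>p\<close> and \<open>q\<close>
  agree keep their length. If no three points of \<open>p\<close> or of \<open>q\<close> are collinear, no triangle degenerates
  along the way, and building up the 3-tree vertex by vertex gives a continuous path of
  configurations in three-dimensional space with these lengths, starting at \<open>p\<close>.

  In general approximate \<open>p\<close> and \<open>q\<close> by such configurations. The resulting paths are connected sets
  inside a fixed compact set. Since components and quasi-components of a compact space
  coincide, the component of \<open>p\<close> in the limit space contains a configuration with the lengths of \<open>q\<close>.
\<close>

unbundle cross3_syntax

section \<open>Gram determinants and moving congruent triangles and tetrahedra\<close>

text \<open>The squared area of the parallelogram on \<open>u\<close> and \<open>w\<close>. As a
  polynomial in inner products it transfers between spaces of different dimension and is visibly
  continuous.\<close>

definition gram :: "'h::real_inner \<Rightarrow> 'h \<Rightarrow> real" where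
  "gram u w = (u \<bullet> u) * (w \<bullet> w) - (u \<bullet> w)\<^sup>2"

text \<open>This is the equality case of the Cauchy-Schwarz inequality.\<close>

lemma gram_eq_0_iff: "gram u w = 0 \<longleftrightarrow> collinear {0, u, w}" for u w :: "'h::euclidean_space"
proof -
  have "gram u w = 0 \<longleftrightarrow> \<bar>u \<bullet> w\<bar>\<^sup>2 = (norm u * norm w)\<^sup>2"
    by (auto simp: gram_def power_mult_distrib power2_norm_eq_inner)
  also have "\<dots> \<longleftrightarrow> \<bar>u \<bullet> w\<bar> = norm u * norm w"
    by (metis abs_ge_zero mult_nonneg_nonneg norm_ge_zero power2_eq_iff_nonneg)
  also have "\<dots> \<longleftrightarrow> collinear {0, u, w}"
    by (rule norm_cauchy_schwarz_equal)
  finally show ?thesis .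
qed

lemma gram_nonneg: "0 \<le> gram u w"
  by (simp add: gram_def Cauchy_Schwarz_ineq)

text \<open>Polarization. The two types differ because lengths in three-dimensional space are
  compared with lengths in the space of the interpolation.\<close>

lemma inner_eq_if_norms_eq:
  fixes u w :: "'g::real_inner" and U W :: "'h::real_inner"
  assumes "norm u = norm U" "norm w = norm W" "norm (u - w) = norm (U - W)"
  shows "u \<bullet> w = U \<bullet> W"
  using assms by (simp add: dot_norm_neg)

text \<open>The path is the Gram--Cramer solution in the plane of \<open>u t\<close> and \<open>w t\<close>, plus a multiple of the
  normal whose sign is fixed by \<open>x0\<close> and whose length is the distance of \<open>X t\<close> from the span of
  \<open>U t\<close> and \<open>W t\<close>.\<close>

lemma attach_path:
  fixes u w :: "real \<Rightarrow> real^3" and U W X :: "real \<Rightarrow> 'h::real_inner"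
  assumes cont: "continuous_on {0..1} u" "continuous_on {0..1} w"
      "continuous_on {0..1} U" "continuous_on {0..1} W" "continuous_on {0..1} X"
    and uu: "\<And>t. t \<in> {0..1} \<Longrightarrow> u t \<bullet> u t = U t \<bullet> U t"
    and uw: "\<And>t. t \<in> {0..1} \<Longrightarrow> u t \<bullet> w t = U t \<bullet> W t"
    and ww: "\<And>t. t \<in> {0..1} \<Longrightarrow> w t \<bullet> w t = W t \<bullet> W t"
    and nz: "\<And>t. t \<in> {0..1} \<Longrightarrow> gram (U t) (W t) \<noteq> 0"
    and x0: "x0 \<bullet> u 0 = X 0 \<bullet> U 0" "x0 \<bullet> w 0 = X 0 \<bullet> W 0" "x0 \<bullet> x0 = X 0 \<bullet> X 0"
  obtains x where "continuous_on {0..1} x" "x 0 = x0"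
    "\<And>t. t \<in> {0..1} \<Longrightarrow> x t \<bullet> u t = X t \<bullet> U t"
    "\<And>t. t \<in> {0..1} \<Longrightarrow> x t \<bullet> w t = X t \<bullet> W t"
    "\<And>t. t \<in> {0..1} \<Longrightarrow> x t \<bullet> x t = X t \<bullet> X t"
proof -
  define D where "D t = gram (U t) (W t)" for t
  define \<alpha> where "\<alpha> t = ((X t \<bullet> U t) * (W t \<bullet> W t) - (X t \<bullet> W t) * (U t \<bullet> W t)) / D t" for t
  define \<beta> where "\<beta> t = ((X t \<bullet> W t) * (U t \<bullet> U t) - (X t \<bullet> U t) * (U t \<bullet> W t)) / D t" for t
  define y where "y t = \<alpha> t *\<^sub>R u t + \<beta> t *\<^sub>R w t" for t
  define Y where "Y t = \<alpha> t *\<^sub>R U t + \<beta> t *\<^sub>R W t" for t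
  define n where "n t = u t \<times> w t" for t
  define h where "h t = (X t - Y t) \<bullet> (X t - Y t)" for t
  \<comment> \<open>The sign is 1, not 0, when the inner product vanishes: \<open>h\<close> may be
    zero at time 0 and positive later, so \<sigma> must always have square 1.\<close>
  define \<sigma> :: real where "\<sigma> = (if (x0 - y 0) \<bullet> n 0 < 0 then -1 else 1)"
  define x where "x t = y t + (\<sigma> * sqrt (h t / D t)) *\<^sub>R n t" for t
  have Dpos: "D t > 0" if "t \<in> {0..1}" for t
    using nz[OF that] gram_nonneg[of "U t" "W t"] by (simp add: D_def)
  have nn: "n t \<bullet> n t = D t" if "t \<in> {0..1}" for t
    using norm_cross_dot[of "u t" "w t"] uu[OF that] uw[OF that] ww[OF that]
    by (simp add: n_def D_def gram_def power_mult_distrib power2_norm_eq_inner)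
  have nu: "n t \<bullet> u t = 0" "n t \<bullet> w t = 0" for t
    by (simp_all add: n_def dot_cross_self inner_commute)
  \<comment> \<open>Cramer's rule for the normal equations of projecting \<open>X t\<close> onto the
    plane, checked after clearing the determinant \<open>D t\<close>.\<close>
  have cramer: "\<alpha> t * (U t \<bullet> U t) + \<beta> t * (U t \<bullet> W t) = X t \<bullet> U t"
      "\<alpha> t * (U t \<bullet> W t) + \<beta> t * (W t \<bullet> W t) = X t \<bullet> W t" if "t \<in> {0..1}" for t
  proof -
    note d = Dpos[OF that]
    have "(\<alpha> t * (U t \<bullet> U t) + \<beta> t * (U t \<bullet> W t)) * D t = (X t \<bullet> U t) * D t"
      using d unfolding \<alpha>_def \<beta>_def
      by (simp add: distrib_right) (simp add: D_def gram_def algebra_simps power2_eq_square)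
    then show "\<alpha> t * (U t \<bullet> U t) + \<beta> t * (U t \<bullet> W t) = X t \<bullet> U t"
      using d by simp
    have "(\<alpha> t * (U t \<bullet> W t) + \<beta> t * (W t \<bullet> W t)) * D t = (X t \<bullet> W t) * D t"
      using d unfolding \<alpha>_def \<beta>_def
      by (simp add: distrib_right) (simp add: D_def gram_def algebra_simps power2_eq_square)
    then show "\<alpha> t * (U t \<bullet> W t) + \<beta> t * (W t \<bullet> W t) = X t \<bullet> W t"
      using d by simp
  qed
  have yu: "y t \<bullet> u t = X t \<bullet> U t" "y t \<bullet> w t = X t \<bullet> W t" if "t \<in> {0..1}" for t
    using cramer[OF that] uu[OF that] uw[OF that] ww[OF that]
    by (simp_all add: y_def inner_add_left inner_add_right inner_commute)
  have YU: "Y t \<bullet> U t = X t \<bullet> U t" "Y t \<bullet> W t = X t \<bullet> W t" if "t \<in> {0..1}" for t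
    using cramer[OF that] by (simp_all add: Y_def inner_add_left inner_add_right inner_commute)
  have yy: "y t \<bullet> y t = Y t \<bullet> Y t" if "t \<in> {0..1}" for t
    using uu[OF that] uw[OF that] ww[OF that]
    by (simp add: y_def Y_def inner_add_left inner_add_right inner_commute)
  \<comment> \<open>Pythagoras: \<open>Y t\<close> is the orthogonal projection of
    \<open>X t\<close>, so \<open>h t\<close> is the squared height over the plane.\<close>
  have XX: "X t \<bullet> X t = Y t \<bullet> Y t + h t" if "t \<in> {0..1}" for t
  proof -
    have "U t \<bullet> (X t - Y t) = 0" "W t \<bullet> (X t - Y t) = 0"
      using YU[OF that] by (simp_all add: inner_diff_right inner_commute)
    then have "(\<alpha> t *\<^sub>R U t + \<beta> t *\<^sub>R W t) \<bullet> (X t - Y t) = 0"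
      by (simp add: inner_add_left)
    then have "Y t \<bullet> (X t - Y t) = 0"
      by (simp only: Y_def)
    then show ?thesis
      by (simp add: h_def inner_diff_left inner_diff_right inner_commute)
  qed
  have ny: "n t \<bullet> y t = 0" for t
    by (simp add: y_def inner_add_right nu)
  have h: "0 \<le> h t" for t
    by (simp add: h_def)
  have \<sigma>2: "\<sigma> * \<sigma> = 1"
    by (simp add: \<sigma>_def)
  have x_u: "x t \<bullet> u t = X t \<bullet> U t" "x t \<bullet> w t = X t \<bullet> W t" if "t \<in> {0..1}" for t
    using yu[OF that] by (simp_all add: x_def inner_add_left nu)
  have x_x: "x t \<bullet> x t = X t \<bullet> X t" if "t \<in> {0..1}" for t
  proof -
    have "x t \<bullet> x t = y t \<bullet> y t + (\<sigma> * \<sigma>) * (sqrt (h t / D t) * sqrt (h t / D t)) * (n t \<bullet> n t)"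
      using ny[of t] by (simp add: x_def inner_add_left inner_add_right inner_commute algebra_simps)
    also have "\<dots> = Y t \<bullet> Y t + h t"
      using h[of t] nn[OF that] Dpos[OF that] yy[OF that] by (simp add: \<sigma>2)
    finally show ?thesis
      using XX[OF that] by simp
  qed
  have x_0: "x 0 = x0"
  proof -
    define z where "z = x0 - y 0"
    have 0: "(0::real) \<in> {0..1}" by simp
    have zu: "z \<bullet> u 0 = 0" "z \<bullet> w 0 = 0"
      using yu[OF 0] x0 by (simp_all add: z_def inner_diff_left)
    \<comment> \<open>A vector orthogonal to both \<open>u 0\<close> and \<open>w 0\<close> is
      parallel to their cross product; the triple product identity yields the coefficient.\<close>
    have "z \<times> n 0 = 0"
      unfolding n_def using zu by (simp add: Lagrange)
    then have "n 0 \<times> (z \<times> n 0) = 0" by simp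
    then have "(n 0 \<bullet> n 0) *\<^sub>R z = (z \<bullet> n 0) *\<^sub>R n 0"
      by (simp add: Lagrange inner_commute)
    then have z: "z = ((z \<bullet> n 0) / D 0) *\<^sub>R n 0"
      using nn[OF 0] Dpos[OF 0] by (simp add: eq_vector_fraction_iff)
    have zy: "z \<bullet> y 0 = 0"
      using zu by (simp add: y_def inner_add_right)
    have "x0 = y 0 + z" by (simp add: z_def)
    then have "x0 \<bullet> x0 = y 0 \<bullet> y 0 + z \<bullet> z"
      using zy by (simp add: inner_add_left inner_add_right inner_commute)
    then have h0: "z \<bullet> z = h 0"
      using x0(3) XX[OF 0] yy[OF 0] by simp
    have "z \<bullet> z = (z \<bullet> n 0) / D 0 * (z \<bullet> n 0)"
      by (subst (2) z) simp
    then have "h 0 / D 0 = ((z \<bullet> n 0) / D 0)\<^sup>2"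
      using h0 Dpos[OF 0] by (simp add: power2_eq_square)
    \<comment> \<open>The root gives only the absolute value of the coefficient; \<sigma> was chosen
      to restore its sign.\<close>
    then have "\<sigma> * sqrt (h 0 / D 0) = (z \<bullet> n 0) / D 0"
      using Dpos[OF 0] by (simp add: \<sigma>_def z_def[symmetric])
    then show ?thesis
      using z by (simp add: x_def z_def)
  qed
  have cD: "continuous_on {0..1} D"
    unfolding D_def gram_def by (intro continuous_intros cont)
  have Dne: "\<forall>t\<in>{0..1}. D t \<noteq> 0"
    using Dpos by fastforce
  have c\<alpha>: "continuous_on {0..1} \<alpha>" and c\<beta>: "continuous_on {0..1} \<beta>"
    unfolding \<alpha>_def \<beta>_def by (intro continuous_intros cont cD Dne)+
  have cx: "continuous_on {0..1} x"
    unfolding x_def y_def h_def Y_def n_def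
    by (intro continuous_intros continuous_on_cross cont cD c\<alpha> c\<beta> Dne)
  show thesis
    by (rule that[OF cx x_0 x_u x_x])
qed

text \<open>Gram-Schmidt: \<open>W t\<close> is split into a multiple of \<open>U t\<close> and an
  orthogonal rest \<open>Z t\<close>. The path keeps the directions of \<open>u0\<close> and
  \<open>z0\<close> fixed and only rescales them, so it stays in one plane.\<close>

lemma triangle_path:
  fixes U W :: "real \<Rightarrow> 'h::real_inner" and u0 w0 :: "'g::real_inner"
  assumes cont: "continuous_on {0..1} U" "continuous_on {0..1} W"
    and nz: "\<And>t. t \<in> {0..1} \<Longrightarrow> gram (U t) (W t) \<noteq> 0"
    and u0: "u0 \<bullet> u0 = U 0 \<bullet> U 0" "u0 \<bullet> w0 = U 0 \<bullet> W 0" "w0 \<bullet> w0 = W 0 \<bullet> W 0"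
  obtains u w where "continuous_on {0..1} u" "continuous_on {0..1} w" "u 0 = u0" "w 0 = w0"
    "\<And>t. t \<in> {0..1} \<Longrightarrow> u t \<bullet> u t = U t \<bullet> U t"
    "\<And>t. t \<in> {0..1} \<Longrightarrow> u t \<bullet> w t = U t \<bullet> W t"
    "\<And>t. t \<in> {0..1} \<Longrightarrow> w t \<bullet> w t = W t \<bullet> W t"
proof -
  define z0 where "z0 = w0 - ((u0 \<bullet> w0) / (u0 \<bullet> u0)) *\<^sub>R u0"
  define Z where "Z t = W t - ((U t \<bullet> W t) / (U t \<bullet> U t)) *\<^sub>R U t" for t
  define u where "u t = (norm (U t) / norm u0) *\<^sub>R u0" for t
  define w where "w t = ((U t \<bullet> W t) / (U t \<bullet> U t)) *\<^sub>R u t + (norm (Z t) / norm z0) *\<^sub>R z0" for t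
  have 0: "(0::real) \<in> {0..1}" by simp
  have Une: "U t \<noteq> 0" if "t \<in> {0..1}" for t
    using nz[OF that] by (auto simp: gram_def)
  have u0ne: "u0 \<noteq> 0"
    using Une[OF 0] u0(1) by auto
  have zz: "z0 \<bullet> z0 = w0 \<bullet> w0 - (u0 \<bullet> w0)\<^sup>2 / (u0 \<bullet> u0)"
    using u0ne by (simp add: z0_def inner_diff_left inner_diff_right inner_commute power2_eq_square)
  have ZZ: "Z t \<bullet> Z t = W t \<bullet> W t - (U t \<bullet> W t)\<^sup>2 / (U t \<bullet> U t)" if "t \<in> {0..1}" for t
    using Une[OF that]
    by (simp add: Z_def inner_diff_left inner_diff_right inner_commute power2_eq_square)
  \<comment> \<open>Squared base times squared height is the squared area, which is nonzero; hence
    \<open>z0\<close> has a direction.\<close>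
  have "(u0 \<bullet> u0) * (z0 \<bullet> z0) = gram (U 0) (W 0)"
    using u0ne u0 by (simp add: zz gram_def right_diff_distrib)
  then have z0ne: "z0 \<noteq> 0"
    using nz[OF 0] by auto
  have uz: "u0 \<bullet> z0 = 0"
    using u0ne by (simp add: z0_def inner_diff_right)
  have uu: "u t \<bullet> u t = U t \<bullet> U t" for t
    using u0ne by (simp add: u_def dot_square_norm power2_eq_square)
  have utz: "u t \<bullet> z0 = 0" for t
    by (simp add: u_def uz)
  have uw: "u t \<bullet> w t = U t \<bullet> W t" if "t \<in> {0..1}" for t
    using Une[OF that] by (simp add: w_def inner_add_right utz uu)
  have ww: "w t \<bullet> w t = W t \<bullet> W t" if "t \<in> {0..1}" for t
  proof -
    have "w t \<bullet> w t = ((U t \<bullet> W t) / (U t \<bullet> U t))\<^sup>2 * (U t \<bullet> U t)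
        + (norm (Z t) / norm z0)\<^sup>2 * (z0 \<bullet> z0)"
      using utz[of t] by (simp add: w_def inner_add_left inner_add_right uu inner_commute power2_eq_square)
    also have "(norm (Z t) / norm z0)\<^sup>2 * (z0 \<bullet> z0) = Z t \<bullet> Z t"
      using z0ne by (simp add: power_divide dot_square_norm)
    also have "((U t \<bullet> W t) / (U t \<bullet> U t))\<^sup>2 * (U t \<bullet> U t) = (U t \<bullet> W t)\<^sup>2 / (U t \<bullet> U t)"
      using Une[OF that] by (simp add: power2_eq_square)
    finally show ?thesis
      using ZZ[OF that] by simp
  qed
  have nU: "norm u0 = norm (U 0)" and nZ: "norm z0 = norm (Z 0)"
    using u0 zz ZZ[OF 0] by (simp_all add: norm_eq_sqrt_inner)
  have u_0: "u 0 = u0"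
    using Une[OF 0] nU by (simp add: u_def)
  have "norm (Z 0) / norm z0 = 1"
    using z0ne nZ by (simp flip: nZ)
  then have "w 0 = ((u0 \<bullet> w0) / (u0 \<bullet> u0)) *\<^sub>R u0 + z0"
    using u0 by (simp only: w_def u_0 scaleR_one)
  then have w_0: "w 0 = w0"
    by (simp add: z0_def)
  have cu: "continuous_on {0..1} u"
    unfolding u_def using u0ne by (intro continuous_intros cont) auto
  have cw: "continuous_on {0..1} w"
    unfolding w_def Z_def using z0ne Une by (intro continuous_intros cont cu) auto
  show thesis
    by (rule that[OF cu cw u_0 w_0 uu uw ww])
qed

section \<open>Lifting paths of noncollinear configurations along a 3-tree\<close>

text \<open>Quantifying over all triples, independently of any edges, lets the condition pass to
  subsets of \<open>V\<close> in inductions.\<close>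

definition noncollinear_on :: "'b set \<Rightarrow> ('b \<Rightarrow> 'h::euclidean_space) \<Rightarrow> bool" where
  "noncollinear_on V P \<longleftrightarrow> (\<forall>x\<in>V. \<forall>y\<in>V. \<forall>z\<in>V. x \<noteq> y \<longrightarrow> y \<noteq> z \<longrightarrow> x \<noteq> z \<longrightarrow> \<not> collinear {P x, P y, P z})"

lemma noncollinear_on_gram:
  assumes "noncollinear_on V P" "a \<in> V" "b \<in> V" "c \<in> V" "a \<noteq> b" "b \<noteq> c" "a \<noteq> c"
  shows "gram (P b - P a) (P c - P a) \<noteq> 0"
proof -
  have "\<not> collinear {P b, P a, P c}"
    using assms unfolding noncollinear_on_def by metis
  moreover have "collinear {P b, P a, P c} \<longleftrightarrow> collinear {0, P b - P a, P c - P a}"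
    by (rule collinear_3) (simp add: NO_MATCH_def)
  ultimately show ?thesis
    by (simp add: gram_eq_0_iff)
qed

text \<open>With \<open>a\<close> moved to the origin, the lifted triangle \<open>a\<close>,
  \<open>b\<close>, \<open>c\<close> is congruent to that of \<open>P t\<close> at all times, so
  \<open>attach_path\<close> supplies the position of \<open>v\<close> relative to it.
  \<open>E\<close> is arbitrary apart from containing the triangle, so that the step also builds
  \<open>K4\<close> from a single triangle.\<close>

lemma lift_path_insert:
  fixes P :: "real \<Rightarrow> 'b \<Rightarrow> 'h::euclidean_space" and p :: "'b \<Rightarrow> real^3"
  assumes g: "\<And>x. x \<in> V \<Longrightarrow> continuous_on {0..1} (\<lambda>t. g t x)" "\<And>x. x \<in> V \<Longrightarrow> g 0 x = p x"
      "\<And>t x y. t \<in> {0..1} \<Longrightarrow> {x, y} \<in> E \<Longrightarrow> norm (g t x - g t y) = norm (P t x - P t y)"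
    and P: "\<And>x. x \<in> insert v V \<Longrightarrow> continuous_on {0..1} (\<lambda>t. P t x)"
      "\<And>t. t \<in> {0..1} \<Longrightarrow> noncollinear_on (insert v V) (P t)"
    and p: "\<And>x y. {x, y} \<in> E \<union> {{v, a}, {v, b}, {v, c}} \<Longrightarrow> norm (p x - p y) = norm (P 0 x - P 0 y)"
    and E: "\<Union>E \<subseteq> V" "v \<notin> V"
    and abc: "a \<in> V" "b \<in> V" "c \<in> V" "a \<noteq> b" "b \<noteq> c" "a \<noteq> c"
      "{a, b} \<in> E" "{b, c} \<in> E" "{a, c} \<in> E"
  obtains g' :: "real \<Rightarrow> 'b \<Rightarrow> real^3"
  where "\<And>x. x \<in> insert v V \<Longrightarrow> continuous_on {0..1} (\<lambda>t. g' t x)" "\<And>x. x \<in> insert v V \<Longrightarrow> g' 0 x = p x"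
      "\<And>t x y. t \<in> {0..1} \<Longrightarrow> {x, y} \<in> E \<union> {{v, a}, {v, b}, {v, c}} \<Longrightarrow>
        norm (g' t x - g' t y) = norm (P t x - P t y)"
proof -
  define u where "u t = g t b - g t a" for t
  define w where "w t = g t c - g t a" for t
  define U where "U t = P t b - P t a" for t
  define W where "W t = P t c - P t a" for t
  define X where "X t = P t v - P t a" for t
  define x0 where "x0 = p v - p a"
  have cont: "continuous_on {0..1} u" "continuous_on {0..1} w"
      "continuous_on {0..1} U" "continuous_on {0..1} W" "continuous_on {0..1} X"
    unfolding u_def w_def U_def W_def X_def
    using abc by (auto intro!: continuous_intros g P)
  have n: "norm (u t) = norm (U t)" "norm (w t) = norm (W t)" "norm (u t - w t) = norm (U t - W t)"
    if "t \<in> {0..1}" for t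
    using g(3)[OF that, of a b] g(3)[OF that, of b c] g(3)[OF that, of a c] abc(7-9)
    by (simp_all add: u_def w_def U_def W_def norm_minus_commute)
  have i: "u t \<bullet> u t = U t \<bullet> U t" "u t \<bullet> w t = U t \<bullet> W t" "w t \<bullet> w t = W t \<bullet> W t"
    if "t \<in> {0..1}" for t
    using n[OF that] inner_eq_if_norms_eq[OF n[OF that]] by (simp_all add: dot_square_norm)
  have nz: "gram (U t) (W t) \<noteq> 0" if "t \<in> {0..1}" for t
    unfolding U_def W_def using noncollinear_on_gram[OF P(2)[OF that]] abc by blast
  have 0: "(0::real) \<in> {0..1}" by simp
  have m: "norm x0 = norm (X 0)" "norm (x0 - u 0) = norm (X 0 - U 0)" "norm (x0 - w 0) = norm (X 0 - W 0)"
    using p[of v a] p[of v b] p[of v c] abc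
    by (simp_all add: x0_def X_def u_def U_def w_def W_def g(2))
  have x0: "x0 \<bullet> u 0 = X 0 \<bullet> U 0" "x0 \<bullet> w 0 = X 0 \<bullet> W 0" "x0 \<bullet> x0 = X 0 \<bullet> X 0"
    using inner_eq_if_norms_eq[OF m(1) n(1)[OF 0] m(2)] inner_eq_if_norms_eq[OF m(1) n(2)[OF 0] m(3)] m(1)
    by (simp_all add: dot_square_norm)
  obtain x where x: "continuous_on {0..1} x" "x 0 = x0"
    "\<And>t. t \<in> {0..1} \<Longrightarrow> x t \<bullet> u t = X t \<bullet> U t"
    "\<And>t. t \<in> {0..1} \<Longrightarrow> x t \<bullet> w t = X t \<bullet> W t"
    "\<And>t. t \<in> {0..1} \<Longrightarrow> x t \<bullet> x t = X t \<bullet> X t"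
    using attach_path[OF cont i nz x0] by blast
  define g' where "g' t = (g t)(v := g t a + x t)" for t
  have old: "g' t y = g t y" if "y \<in> V" for t y
    using that E(2) by (auto simp: g'_def)
  have new: "g' t v = g t a + x t" for t
    by (simp add: g'_def)
  have va: "norm (g' t v - g t a) = norm (P t v - P t a)"
    and vb: "norm (g' t v - g t b) = norm (P t v - P t b)"
    and vc: "norm (g' t v - g t c) = norm (P t v - P t c)" if t: "t \<in> {0..1}" for t
  proof -
    have "norm (x t) = norm (X t)"
      using x(5)[OF t] by (simp add: norm_eq_sqrt_inner)
    then show "norm (g' t v - g t a) = norm (P t v - P t a)"
      by (simp add: new X_def)
    have "norm (x t - u t) = norm (X t - U t)"
      using x(3,5)[OF t] i(1)[OF t]
      by (simp add: norm_eq_sqrt_inner inner_diff_left inner_diff_right inner_commute)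
    then show "norm (g' t v - g t b) = norm (P t v - P t b)"
      by (simp add: new X_def u_def U_def algebra_simps)
    have "norm (x t - w t) = norm (X t - W t)"
      using x(4,5)[OF t] i(3)[OF t]
      by (simp add: norm_eq_sqrt_inner inner_diff_left inner_diff_right inner_commute)
    then show "norm (g' t v - g t c) = norm (P t v - P t c)"
      by (simp add: new X_def w_def W_def algebra_simps)
  qed
  show thesis
  proof (rule that[of g'])
    fix y assume y: "y \<in> insert v V"
    show "continuous_on {0..1} (\<lambda>t. g' t y)"
    proof (cases "y = v")
      case True
      then show ?thesis using abc by (auto simp: new intro!: continuous_intros g x)
    next
      case False
      then show ?thesis using y by (auto simp: old intro!: g)
    qed
    show "g' 0 y = p y"
      using y abc by (auto simp: new old g(2) x(2) x0_def)
  next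
    fix t :: real and y z
    assume t: "t \<in> {0..1}" and yz: "{y, z} \<in> E \<union> {{v, a}, {v, b}, {v, c}}"
    then consider "{y, z} \<in> E" | "{y, z} = {v, a}" | "{y, z} = {v, b}" | "{y, z} = {v, c}"
      by blast
    then show "norm (g' t y - g' t z) = norm (P t y - P t z)"
    proof cases
      case 1
      then have "y \<in> V" "z \<in> V" using E(1) by auto
      then show ?thesis using g(3)[OF t 1] by (simp add: old)
    qed (use va[OF t] vb[OF t] vc[OF t] abc in \<open>auto simp: doubleton_eq_iff old norm_minus_commute\<close>)
  qed
qed

lemma three_tree_finite: "three_tree V E \<Longrightarrow> finite V"
  by (induction rule: three_tree.induct) (auto intro: card_ge_0_finite)

lemma three_tree_nonempty: "three_tree V E \<Longrightarrow> V \<noteq> {}"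
  by (induction rule: three_tree.induct) auto

lemma three_tree_edges_subset: "three_tree V E \<Longrightarrow> \<Union>E \<subseteq> V"
  by (induction rule: three_tree.induct) auto

text \<open>Induction on the construction of the 3-tree. The base case moves a triangle by
  \<open>triangle_path\<close>; the fourth vertex of \<open>K4\<close> and every later vertex are
  attached by \<open>lift_path_insert\<close>.\<close>

lemma three_tree_lift_path:
  fixes P :: "real \<Rightarrow> nat \<Rightarrow> 'h::euclidean_space" and p :: "nat \<Rightarrow> real^3"
  assumes "three_tree V E"
    and "\<And>x. x \<in> V \<Longrightarrow> continuous_on {0..1} (\<lambda>t. P t x)"
    and "\<And>t. t \<in> {0..1} \<Longrightarrow> noncollinear_on V (P t)"
    and "\<And>x y. {x, y} \<in> E \<Longrightarrow> norm (p x - p y) = norm (P 0 x - P 0 y)"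
  shows "\<exists>g. (\<forall>x\<in>V. continuous_on {0..1} (\<lambda>t. g t x)) \<and> (\<forall>x\<in>V. g 0 x = p x) \<and>
    (\<forall>t\<in>{0..1}. \<forall>x y. {x, y} \<in> E \<longrightarrow> norm (g t x - g t y) = norm (P t x - P t y))"
  using assms
proof (induction rule: three_tree.induct)
  case (K4 V E)
  obtain d V3 where V3: "V = insert d V3" "d \<notin> V3" "card V3 = 3"
    using K4(1) card_eq_SucD[of V 3] by auto
  then obtain a b c where abc: "V3 = {a, b, c}" "a \<noteq> b" "b \<noteq> c" "a \<noteq> c"
    by (metis card_3_iff)
  have V: "V = {d, a, b, c}" and dist: "a \<noteq> b" "b \<noteq> c" "a \<noteq> c" "d \<notin> {a, b, c}"
    using V3 abc by auto
  let ?E3 = "{{a, b}, {b, c}, {a, c}}"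
  have pE: "norm (p x - p y) = norm (P 0 x - P 0 y)"
    if "{x, y} \<in> ?E3 \<union> {{d, a}, {d, b}, {d, c}}" for x y
  proof (rule K4(5))
    have "{x, y} \<subseteq> V" "x \<noteq> y"
      using that dist by (auto simp: V doubleton_eq_iff)
    then show "{x, y} \<in> E" by (simp add: K4(2))
  qed
  define u0 where "u0 = p b - p a"
  define w0 where "w0 = p c - p a"
  define U where "U t = P t b - P t a" for t
  define W where "W t = P t c - P t a" for t
  have cont: "continuous_on {0..1} U" "continuous_on {0..1} W"
    unfolding U_def W_def by (auto intro!: continuous_intros K4(3) simp: V)
  have nz: "gram (U t) (W t) \<noteq> 0" if "t \<in> {0..1}" for t
    unfolding U_def W_def using noncollinear_on_gram[OF K4(4)[OF that]] dist by (simp add: V)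
  have n: "norm u0 = norm (U 0)" "norm w0 = norm (W 0)" "norm (u0 - w0) = norm (U 0 - W 0)"
    using pE[of b a] pE[of c a] pE[of b c]
    by (simp_all add: u0_def w0_def U_def W_def insert_commute)
  have i: "u0 \<bullet> u0 = U 0 \<bullet> U 0" "u0 \<bullet> w0 = U 0 \<bullet> W 0" "w0 \<bullet> w0 = W 0 \<bullet> W 0"
    using n inner_eq_if_norms_eq[OF n] by (simp_all add: dot_square_norm)
  obtain u w where uw: "continuous_on {0..1} u" "continuous_on {0..1} w" "u 0 = u0" "w 0 = w0"
    "\<And>t. t \<in> {0..1} \<Longrightarrow> u t \<bullet> u t = U t \<bullet> U t"
    "\<And>t. t \<in> {0..1} \<Longrightarrow> u t \<bullet> w t = U t \<bullet> W t"
    "\<And>t. t \<in> {0..1} \<Longrightarrow> w t \<bullet> w t = W t \<bullet> W t"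
    using triangle_path[OF cont nz i] by blast
  \<comment> \<open>The vertex \<open>a\<close> stays at its initial position, which turns the
    vectors \<open>u t\<close> and \<open>w t\<close> into a moving triangle.\<close>
  define g where "g t = (\<lambda>_. p a)(b := p a + u t, c := p a + w t)" for t
  have g_simps: "g t a = p a" "g t b = p a + u t" "g t c = p a + w t" for t
    using dist by (simp_all add: g_def)
  have nuw: "norm (u t) = norm (P t b - P t a)" "norm (w t) = norm (P t c - P t a)"
    "norm (u t - w t) = norm (P t b - P t c)" if t: "t \<in> {0..1}" for t
  proof -
    show "norm (u t) = norm (P t b - P t a)" "norm (w t) = norm (P t c - P t a)"
      using uw(5,7)[OF t] by (simp_all add: U_def W_def norm_eq_sqrt_inner)
    have "norm (u t - w t) = norm (U t - W t)"
      using uw(5-7)[OF t] by (simp add: norm_eq_sqrt_inner inner_diff_left inner_diff_right inner_commute)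
    then show "norm (u t - w t) = norm (P t b - P t c)"
      by (simp add: U_def W_def)
  qed
  have gE: "norm (g t x - g t y) = norm (P t x - P t y)" if t: "t \<in> {0..1}" and "{x, y} \<in> ?E3" for t x y
    using that(2) nuw[OF t] by (auto simp: doubleton_eq_iff g_simps norm_minus_commute)
  have gc: "continuous_on {0..1} (\<lambda>t. g t x)" if "x \<in> {a, b, c}" for x
    using that by (auto simp: g_simps intro!: continuous_intros uw)
  have g0: "g 0 x = p x" if "x \<in> {a, b, c}" for x
    using that uw(3,4) by (auto simp: g_simps u0_def w0_def)
  have P: "\<And>x. x \<in> insert d {a, b, c} \<Longrightarrow> continuous_on {0..1} (\<lambda>t. P t x)"
      "\<And>t. t \<in> {0..1} \<Longrightarrow> noncollinear_on (insert d {a, b, c}) (P t)"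
    using K4(3,4) unfolding V by blast+
  have E3: "\<Union>?E3 \<subseteq> {a, b, c}" "a \<in> {a, b, c}" "b \<in> {a, b, c}" "c \<in> {a, b, c}"
      "{a, b} \<in> ?E3" "{b, c} \<in> ?E3" "{a, c} \<in> ?E3"
    by auto
  obtain g' :: "real \<Rightarrow> nat \<Rightarrow> real^3"
    where "\<And>x. x \<in> insert d {a, b, c} \<Longrightarrow> continuous_on {0..1} (\<lambda>t. g' t x)"
      "\<And>x. x \<in> insert d {a, b, c} \<Longrightarrow> g' 0 x = p x"
      "\<And>t x y. t \<in> {0..1} \<Longrightarrow> {x, y} \<in> ?E3 \<union> {{d, a}, {d, b}, {d, c}} \<Longrightarrow>
        norm (g' t x - g' t y) = norm (P t x - P t y)"
    by (rule lift_path_insert[OF gc g0 gE P pE E3(1) dist(4) E3(2-4) dist(1-3) E3(5-7)]) blast+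
  moreover have "{x, y} \<in> ?E3 \<union> {{d, a}, {d, b}, {d, c}}" if "{x, y} \<in> E" for x y
  proof -
    have "card {x, y} = 2" "x \<in> V" "y \<in> V"
      using that by (auto simp: K4(2))
    then have "x \<noteq> y" "x \<in> {d, a, b, c}" "y \<in> {d, a, b, c}"
      by (auto simp: V)
    then show ?thesis
      by (elim insertE) (simp_all add: doubleton_eq_iff)
  qed
  ultimately show ?case
    unfolding V by (intro exI[of _ g'] conjI ballI allI impI) auto
next
  case (add V E a b c v)
  have "\<exists>g. (\<forall>x\<in>V. continuous_on {0..1} (\<lambda>t. g t x)) \<and> (\<forall>x\<in>V. g 0 x = p x) \<and>
    (\<forall>t\<in>{0..1}. \<forall>x y. {x, y} \<in> E \<longrightarrow> norm (g t x - g t y) = norm (P t x - P t y))"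
  proof (rule add.IH)
    show "noncollinear_on V (P t)" if "t \<in> {0..1}" for t
      using add.prems(2)[OF that] by (auto simp: noncollinear_on_def)
  qed (use add.prems in auto)
  then obtain g where g: "\<And>x. x \<in> V \<Longrightarrow> continuous_on {0..1} (\<lambda>t. g t x)" "\<And>x. x \<in> V \<Longrightarrow> g 0 x = p x"
      "\<And>t x y. t \<in> {0..1} \<Longrightarrow> {x, y} \<in> E \<Longrightarrow> norm (g t x - g t y) = norm (P t x - P t y)"
    by blast
  obtain g' :: "real \<Rightarrow> nat \<Rightarrow> real^3"
    where "\<And>x. x \<in> insert v V \<Longrightarrow> continuous_on {0..1} (\<lambda>t. g' t x)" "\<And>x. x \<in> insert v V \<Longrightarrow> g' 0 x = p x"
      "\<And>t x y. t \<in> {0..1} \<Longrightarrow> {x, y} \<in> E \<union> {{v, a}, {v, b}, {v, c}} \<Longrightarrow>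
        norm (g' t x - g' t y) = norm (P t x - P t y)"
    by (rule lift_path_insert[OF g add.prems three_tree_edges_subset[OF add.hyps(1)]
      add.hyps(11) add.hyps(2-10)]) blast+
  then show ?case by blast
qed

section \<open>Uniform bounds and approximation by noncollinear configurations\<close>

text \<open>Triangle inequality along paths of at most \<open>N\<close> edges; a new vertex is one
  edge away from \<open>a\<close>. Since \<open>N\<close> is chosen before \<open>r\<close> and
  \<open>D\<close>, one constant serves all approximating paths at all times.\<close>

lemma three_tree_diameter_bound:
  assumes "three_tree V E"
  obtains N :: nat where "\<And>(r :: nat \<Rightarrow> 'h::real_normed_vector) (D :: real) x y. 0 \<le> D \<Longrightarrow>
    (\<And>x y. {x, y} \<in> E \<Longrightarrow> norm (r x - r y) \<le> D) \<Longrightarrow> x \<in> V \<Longrightarrow> y \<in> V \<Longrightarrow>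
    norm (r x - r y) \<le> N * D"
proof -
  have "\<exists>N::nat. \<forall>(r :: nat \<Rightarrow> 'h) (D :: real). 0 \<le> D \<longrightarrow> (\<forall>x y. {x, y} \<in> E \<longrightarrow> norm (r x - r y) \<le> D)
    \<longrightarrow> (\<forall>x\<in>V. \<forall>y\<in>V. norm (r x - r y) \<le> N * D)"
    using assms
  proof (induction rule: three_tree.induct)
    case (K4 V E)
    have "norm (r x - r y) \<le> real 1 * D"
      if "0 \<le> D" "\<forall>x y. {x, y} \<in> E \<longrightarrow> norm (r x - r y) \<le> D" "x \<in> V" "y \<in> V"
      for r :: "nat \<Rightarrow> 'h" and D :: real and x y
      using that K4 by (cases "x = y") auto
    then show ?case by (intro exI[of _ 1]) blast
  next
    case (add V E a b c v)
    from add.IH obtain N :: nat where N: "\<forall>(r :: nat \<Rightarrow> 'h) (D :: real). 0 \<le> D \<longrightarrow>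
        (\<forall>x y. {x, y} \<in> E \<longrightarrow> norm (r x - r y) \<le> D) \<longrightarrow> (\<forall>x\<in>V. \<forall>y\<in>V. norm (r x - r y) \<le> N * D)" ..
    have step: "norm (r x - r y) \<le> real (Suc N) * D"
      if D: "0 \<le> D" and r: "\<forall>x y. {x, y} \<in> E \<union> {{v, a}, {v, b}, {v, c}} \<longrightarrow> norm (r x - r y) \<le> D"
        and xy: "x \<in> insert v V" "y \<in> insert v V"
      for r :: "nat \<Rightarrow> 'h" and D :: real and x y
    proof -
      have old: "norm (r x - r y) \<le> N * D" if "x \<in> V" "y \<in> V" for x y
        using N[rule_format, of D r x y] D r that by auto
      have va: "norm (r v - r a) \<le> D" using r by blast
      have new: "norm (r v - r y) \<le> D + N * D" if "y \<in> V" for y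
        using norm_triangle_ineq[of "r v - r a" "r a - r y"] va old[OF \<open>a \<in> V\<close> that] by simp
      have "0 \<le> N * D" using D by simp
      with xy old[of x y] new[of x] new[of y] D show ?thesis
        by (auto simp: distrib_right norm_minus_commute)
    qed
    show ?case by (intro exI[of _ "Suc N"] allI impI ballI, rule step)
  qed
  then obtain N :: nat where "\<forall>(r :: nat \<Rightarrow> 'h) (D :: real). 0 \<le> D \<longrightarrow>
      (\<forall>x y. {x, y} \<in> E \<longrightarrow> norm (r x - r y) \<le> D) \<longrightarrow> (\<forall>x\<in>V. \<forall>y\<in>V. norm (r x - r y) \<le> N * D)" ..
  then show thesis by (intro that[of N]) auto
qed

text \<open>The affine hull lies in the linear span of two points, whose dimension is below
  3.\<close>

lemma negligible_affine_hull_2: "negligible (affine hull {x, y :: real^3})"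
proof -
  have "dim (affine hull {x, y}) \<le> dim (span {x, y})"
    by (intro dim_subset affine_hull_subset_span)
  also have "\<dots> \<le> card {x, y}"
    by (simp add: dim_le_card')
  also have "\<dots> \<le> 2"
    by (simp add: card_insert_if)
  finally show ?thesis
    by (intro negligible_lowdim) simp
qed

text \<open>Points are placed one at a time, each off the lines through earlier points: these form a
  null set, while a ball is not null. Injectivity is carried along because noncollinearity does not
  exclude coincidences among fewer than three points.\<close>

lemma noncollinear_on_dense:
  fixes p :: "'b \<Rightarrow> real^3"
  assumes "finite V" "0 < e"
  shows "\<exists>p'. noncollinear_on V p' \<and> inj_on p' V \<and> (\<forall>x\<in>V. dist (p' x) (p x) < e)"
  using assms(1)
proof (induction rule: finite_induct)
  case empty
  then show ?case by (auto simp: noncollinear_on_def)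
next
  case (insert v V)
  then obtain p' where p': "noncollinear_on V p'" "inj_on p' V" "\<And>x. x \<in> V \<Longrightarrow> dist (p' x) (p x) < e"
    by blast
  \<comment> \<open>The case of equal \<open>x\<close> and \<open>y\<close> contributes the earlier
    points themselves, so a point outside \<open>L\<close> is also new.\<close>
  define L where "L = (\<Union>x\<in>V. \<Union>y\<in>V. affine hull {p' x, p' y})"
  have "negligible L"
    unfolding L_def using insert.hyps(1) by (auto intro!: negligible_Union negligible_affine_hull_2)
  moreover have "\<not> negligible (ball (p v) e)"
    using assms(2) by (simp add: open_not_negligible)
  ultimately obtain z where z: "z \<in> ball (p v) e" "z \<notin> L"
    by (meson negligible_subset subsetI)
  define q where "q = p'(v := z)"
  have old: "q x = p' x" if "x \<in> V" for x
    using that insert.hyps(2) by (auto simp: q_def)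
  have qv: "q v = z" by (simp add: q_def)
  have zV: "z \<noteq> p' x" if "x \<in> V" for x
    using z(2) that hull_inc[of "p' x" "{p' x, p' x}" affine] unfolding L_def by blast
  have zc: "\<not> collinear {p' x, p' y, z}" if "x \<in> V" "y \<in> V" "x \<noteq> y" for x y
  proof -
    have "p' x \<noteq> p' y" using p'(2) that by (auto dest: inj_onD)
    then show ?thesis
      using z(2) that collinear_3_affine_hull[of "p' x" "p' y" z] by (auto simp: L_def)
  qed
  have "noncollinear_on (insert v V) q"
    unfolding noncollinear_on_def
  proof (intro ballI impI)
    fix x y w assume *: "x \<in> insert v V" "y \<in> insert v V" "w \<in> insert v V" "x \<noteq> y" "y \<noteq> w" "x \<noteq> w"
    then consider "x = v" "y \<in> V" "w \<in> V" | "y = v" "x \<in> V" "w \<in> V" | "w = v" "x \<in> V" "y \<in> V"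
      | "x \<in> V" "y \<in> V" "w \<in> V"
      by auto
    then show "\<not> collinear {q x, q y, q w}"
    proof cases
      case 4
      then show ?thesis using p'(1) * by (simp add: old noncollinear_on_def)
    qed (use * zc in \<open>auto simp: qv old insert_commute\<close>)
  qed
  moreover have "inj_on q (insert v V)"
    using p'(2) zV insert.hyps(2) by (auto simp: inj_on_def qv old)
  moreover have "\<forall>x\<in>insert v V. dist (q x) (p x) < e"
    using p'(3) z(1) by (auto simp: qv old dist_commute)
  ultimately show ?case by blast
qed

section \<open>Limits of connected sets in a compact space\<close>

text \<open>If the component of \<open>a\<close> missed \<open>T\<close>, it could be separated from
  \<open>T\<close> inside \<open>K\<close>. For large indices along a subsequence the connected sets
  would meet both sides and hence contain points outside both; a limit of such points would lie in
  \<open>K\<close> outside the separation.\<close>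

lemma connected_component_limit:
  fixes S :: "nat \<Rightarrow> 'b::metric_space set"
  assumes C: "compact C" "\<And>n. S n \<subseteq> C" and S: "\<And>n. connected (S n)" "\<And>n. x n \<in> S n" "\<And>n. y n \<in> S n"
    and x: "x \<longlonglongrightarrow> a"
    and K: "closed K" "K \<subseteq> C"
      "\<And>z \<sigma> r. strict_mono \<sigma> \<Longrightarrow> (\<And>n. z n \<in> S (\<sigma> n)) \<Longrightarrow> z \<longlonglongrightarrow> r \<Longrightarrow> r \<in> K"
    and T: "closed T" "\<And>\<sigma> r. strict_mono \<sigma> \<Longrightarrow> (y \<circ> \<sigma>) \<longlonglongrightarrow> r \<Longrightarrow> r \<in> T"
  shows "\<exists>b\<in>T. connected_component K a b"
proof (rule ccontr)
  assume neg: "\<not> ?thesis"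
  have aK: "a \<in> K"
    by (rule K(3)[of id x]) (auto simp: strict_mono_def S x)
  have cK: "compact K"
    using C(1) K(1,2) compact_Int_closed by (metis inf.absorb_iff2)
  let ?X = "top_of_set K"
  have "compact_space ?X"
    using cK by (simp add: compact_space_subtopology)
  have H: "Hausdorff_space ?X"
    by (simp add: Hausdorff_space_subtopology)
  let ?A = "connected_component_set K a"
  have clA: "closedin ?X ?A"
    by (rule closedin_connected_component)
  \<comment> \<open>Here components and quasi-components coincide, by compactness of
    \<open>K\<close>.\<close>
  have "separated_between ?X ?A (K \<inter> T)"
  proof (rule separated_between_compact_connected_component)
    show "locally_compact_space ?X"
      using \<open>compact_space ?X\<close> compact_imp_locally_compact_space by blast
    show "?A \<in> connected_components_of ?X"
      using aK unfolding connected_components_of_def connected_component_of_def connected_component_def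
      by (auto simp: connectedin_subtopology intro!: image_eqI[of _ _ a])
    show "compactin ?X ?A"
      using clA \<open>compact_space ?X\<close> closedin_compact_space by blast
    show "closedin ?X (K \<inter> T)"
      using T(1) by (simp add: closedin_closed_Int)
    show "disjnt ?A (K \<inter> T)"
      using neg by (auto simp: disjnt_iff)
  qed (rule H)
  then obtain U1 U2 where U: "openin ?X U1" "openin ?X U2" "U1 \<union> U2 = K" "disjnt U1 U2"
      "?A \<subseteq> U1" "K \<inter> T \<subseteq> U2"
    by (auto simp: separated_between_def)
  have "U1 = K - U2" "U2 = K - U1"
    using U(3,4) by (auto simp: disjnt_iff)
  then have "closedin ?X U1" "closedin ?X U2"
    using U(1,2) by (metis closedin_diff closedin_topspace topspace_euclidean_subtopology)+
  then have "closed U1" "closed U2"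
    using K(1) closedin_closed_trans by blast+
  \<comment> \<open>The sets \<open>S n\<close> may leave \<open>K\<close>, so the two clopen pieces
    of \<open>K\<close> are thickened to disjoint open sets of the whole space.\<close>
  then obtain O1 O2 where O: "open O1" "open O2" "U1 \<subseteq> O1" "U2 \<subseteq> O2" "O1 \<inter> O2 = {}"
    using t4_space[of U1 U2] U(4) by (auto simp: disjnt_def)
  have "a \<in> O1"
    using connected_component_refl[OF aK] U(5) O(3) by (metis mem_Collect_eq subsetD)
  then have ev: "\<forall>\<^sub>F n in sequentially. x n \<in> O1"
    using x O(1) by (simp add: topological_tendstoD)
  obtain b \<sigma> where \<sigma>: "strict_mono \<sigma>" "(y \<circ> \<sigma>) \<longlonglongrightarrow> b"
    using C S(3) unfolding compact_def seq_compact_def by (metis subsetD)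
  have "b \<in> T" "b \<in> K"
    using T(2)[OF \<sigma>] K(3)[OF \<sigma>(1) _ \<sigma>(2)] S(3) by auto
  then have "b \<in> O2" using U(6) O(4) by auto
  then have ev2: "\<forall>\<^sub>F n in sequentially. (y \<circ> \<sigma>) n \<in> O2"
    using \<sigma>(2) O(2) by (simp only: topological_tendstoD)
  have ev1: "\<forall>\<^sub>F n in sequentially. x (\<sigma> n) \<in> O1"
    using ev \<sigma>(1) eventually_subseq by blast
  obtain M where M: "\<And>n. n \<ge> M \<Longrightarrow> x (\<sigma> n) \<in> O1 \<and> y (\<sigma> n) \<in> O2"
    using eventually_conj[OF ev1 ev2] by (auto simp: eventually_sequentially)
  \<comment> \<open>The shift by \<open>M\<close> makes the set meet both open sets for every
    \<open>n\<close>; connectedness then forces a point outside their union.\<close>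
  have "\<exists>z. z \<in> S (\<sigma> (n + M)) \<and> z \<notin> O1 \<union> O2" for n
  proof (rule ccontr)
    assume "\<not> ?thesis"
    then have "S (\<sigma> (n + M)) \<subseteq> O1 \<union> O2" by auto
    then show False
      using connectedD[OF S(1) O(1,2), of "\<sigma> (n + M)"] O(5) M[of "n + M"] S(2,3) by fastforce
  qed
  then obtain z where z: "\<And>n. z n \<in> S (\<sigma> (n + M))" "\<And>n. z n \<notin> O1 \<union> O2"
    by metis
  obtain r \<tau> where \<tau>: "strict_mono \<tau>" "(z \<circ> \<tau>) \<longlonglongrightarrow> r"
    using C z(1) unfolding compact_def seq_compact_def by (metis subsetD)
  have "r \<in> K"
  proof (rule K(3)[OF _ _ \<tau>(2)])
    show "strict_mono (\<lambda>n. \<sigma> (\<tau> n + M))"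
      using \<sigma>(1) \<tau>(1) by (simp add: strict_mono_def)
  qed (simp add: z)
  moreover have "r \<in> - (O1 \<union> O2)"
    using closed_sequentially[OF _ _ \<tau>(2), of "- (O1 \<union> O2)"] z(2) O(1,2) by auto
  ultimately show False
    using U(3) O(3,4) by auto
qed

section \<open>Interpolation between two realizations of a 3-tree\<close>

text \<open>The square roots as weights make squared distances in the product space affine in
  \<open>t\<close>. Projections preserve collinearity, and at each time at least one factor is a
  nonzero multiple of \<open>p\<close> or \<open>q\<close>, so no triple degenerates.\<close>

lemma three_tree_interpolation_path:
  fixes p q :: "nat \<Rightarrow> real^3"
  assumes T: "three_tree V E" and nc: "noncollinear_on V p" "noncollinear_on V q"
    and a: "a \<in> V" and p0: "\<And>x. x \<notin> V \<Longrightarrow> p x = 0"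
  obtains g where "continuous_on {0..1} g" "g 0 = p"
    "\<And>t. g t a = p a" "\<And>t x. x \<notin> V \<Longrightarrow> g t x = 0"
    "\<And>t x y. t \<in> {0..1} \<Longrightarrow> {x, y} \<in> E \<Longrightarrow>
      (norm (g t x - g t y))\<^sup>2 = (1 - t) * (norm (p x - p y))\<^sup>2 + t * (norm (q x - q y))\<^sup>2"
proof -
  define P where "P t x = (sqrt (1 - t) *\<^sub>R p x, sqrt t *\<^sub>R q x)" for t x
  have contP: "continuous_on {0..1} (\<lambda>t. P t x)" for x
    unfolding P_def by (intro continuous_intros)
  have nP: "noncollinear_on V (P t)" if t: "t \<in> {0..1}" for t
    unfolding noncollinear_on_def
  proof (intro ballI impI notI)
    fix x y z assume xyz: "x \<in> V" "y \<in> V" "z \<in> V" "x \<noteq> y" "y \<noteq> z" "x \<noteq> z"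
      and "collinear {P t x, P t y, P t z}"
    then have "collinear (P t ` {x, y, z})" by simp
    then obtain d where d: "\<forall>v\<in>P t ` {x, y, z}. \<forall>w\<in>P t ` {x, y, z}. \<exists>c. v - w = c *\<^sub>R d"
      unfolding collinear_def ..
    have scaled: "\<exists>c. v - w = c *\<^sub>R e" if "s *\<^sub>R v - s *\<^sub>R w = c *\<^sub>R e" "s \<noteq> 0" for s c :: real and v w e :: "real^3"
    proof
      have "v - w = (1 / s) *\<^sub>R (s *\<^sub>R v - s *\<^sub>R w)"
        using that(2) by (simp add: scaleR_diff_right)
      then show "v - w = (c / s) *\<^sub>R e"
        using that(1) by simp
    qed
    show False
    \<comment> \<open>Only at time 1 does the first factor collapse; there the second factor is
      \<open>q\<close> itself.\<close>
    proof (cases "t = 1")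
      case False
      then have s: "sqrt (1 - t) \<noteq> 0" using t by simp
      have "\<exists>c. p v - p w = c *\<^sub>R fst d" if vw: "v \<in> {x, y, z}" "w \<in> {x, y, z}" for v w
      proof -
        obtain c where "P t v - P t w = c *\<^sub>R d" using d vw by blast
        then have "sqrt (1 - t) *\<^sub>R p v - sqrt (1 - t) *\<^sub>R p w = c *\<^sub>R fst d"
          by (metis P_def fst_conv fst_diff fst_scaleR)
        then show ?thesis using scaled s by blast
      qed
      then have "collinear {p x, p y, p z}"
        unfolding collinear_def by blast
      then show False using nc(1) xyz by (simp add: noncollinear_on_def)
    next
      case True
      then have s: "sqrt t \<noteq> 0" by simp
      have "\<exists>c. q v - q w = c *\<^sub>R snd d" if vw: "v \<in> {x, y, z}" "w \<in> {x, y, z}" for v w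
      proof -
        obtain c where "P t v - P t w = c *\<^sub>R d" using d vw by blast
        then have "sqrt t *\<^sub>R q v - sqrt t *\<^sub>R q w = c *\<^sub>R snd d"
          by (metis P_def snd_conv snd_diff snd_scaleR)
        then show ?thesis using scaled s by blast
      qed
      then have "collinear {q x, q y, q z}"
        unfolding collinear_def by blast
      then show False using nc(2) xyz by (simp add: noncollinear_on_def)
    qed
  qed
  have normP: "(norm (P t x - P t y))\<^sup>2 = (1 - t) * (norm (p x - p y))\<^sup>2 + t * (norm (q x - q y))\<^sup>2"
    if "t \<in> {0..1}" for t x y
    using that
    by (simp add: P_def norm_Pair power_mult_distrib flip: scaleR_diff_right)
  have "norm (p x - p y) = norm (P 0 x - P 0 y)" for x y
    by (simp add: P_def norm_Pair)
  from three_tree_lift_path[OF T contP nP this] obtain g where g: "\<And>x. x \<in> V \<Longrightarrow> continuous_on {0..1} (\<lambda>t. g t x)" "\<And>x. x \<in> V \<Longrightarrow> g 0 x = p x"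
    "\<And>t x y. t \<in> {0..1} \<Longrightarrow> {x, y} \<in> E \<Longrightarrow> norm (g t x - g t y) = norm (P t x - P t y)"
    by blast
  \<comment> \<open>A time-dependent translation pins \<open>a\<close> without changing distances,
    so that edge lengths alone bound the whole path.\<close>
  define g' where "g' t x = (if x \<in> V then g t x - g t a + p a else 0)" for t x
  show thesis
  proof (rule that[of g'])
    show "continuous_on {0..1} g'"
    proof (rule continuous_on_coordinatewise_then_product)
      show "continuous_on {0..1} (\<lambda>t. g' t x)" for x
        using a by (cases "x \<in> V") (auto simp: g'_def intro!: continuous_intros g)
    qed
    show "g' 0 = p"
      using a by (auto simp: g'_def g(2) p0)
    fix t x y assume t: "t \<in> {0..(1::real)}" and xy: "{x, y} \<in> E"
    then have "x \<in> V" "y \<in> V"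
      using three_tree_edges_subset[OF T] by auto
    then show "(norm (g' t x - g' t y))\<^sup>2 = (1 - t) * (norm (p x - p y))\<^sup>2 + t * (norm (q x - q y))\<^sup>2"
      using g(3)[OF t xy] normP[OF t] by (simp add: g'_def)
  qed (use a in \<open>auto simp: g'_def\<close>)
qed

section \<open>Compactness of bounded configurations and passage to the limit\<close>

text \<open>Tychonoff's theorem for a product of closed balls.\<close>

lemma compact_bounded_functions:
  "compact {r :: 'b \<Rightarrow> 'h::euclidean_space. \<forall>x. norm (r x) \<le> M}"
proof -
  have "compactin (product_topology (\<lambda>i::'b. euclidean) UNIV) (PiE UNIV (\<lambda>_. cball (0::'h) M))"
    by (simp add: compactin_PiE)
  moreover have "PiE UNIV (\<lambda>_. cball (0::'h) M) = {r :: 'b \<Rightarrow> 'h. \<forall>x. norm (r x) \<le> M}"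
    by auto
  ultimately show ?thesis
    by (simp add: euclidean_product_topology)
qed

lemma tendsto_fun_iff:
  fixes f :: "'c \<Rightarrow> 'b \<Rightarrow> 'h::topological_space"
  shows "(f \<longlongrightarrow> r) F \<longleftrightarrow> (\<forall>x. ((\<lambda>n. f n x) \<longlongrightarrow> r x) F)"
  using limitin_componentwise[of "\<lambda>_. euclidean" UNIV f r F]
  by (simp add: euclidean_product_topology)

lemma closed_norm_diff_eq: "closed {r :: 'b \<Rightarrow> 'h::real_normed_vector. norm (r x - r y) = c}"
  by (intro closed_Collect_eq continuous_intros continuous_on_product_coordinates)

text \<open>Edges on which \<open>p\<close> and \<open>q\<close> agree may have different lengths in
  the approximations \<open>pn n\<close> and \<open>qn n\<close>, so the approximating paths may
  leave the set in question. The deviation tends to 0, so \<open>connected_component_limit\<close>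
  applies.\<close>

lemma three_tree_component_reaches:
  fixes p q :: "nat \<Rightarrow> real^3"
  assumes T: "three_tree V E" and p0: "\<And>x. x \<notin> V \<Longrightarrow> p x = 0"
  shows "\<exists>q'. (\<forall>x y. {x, y} \<in> E \<longrightarrow> norm (q' x - q' y) = norm (q x - q y)) \<and>
    connected_component {r. \<forall>x y. {x, y} \<in> E \<longrightarrow> norm (p x - p y) = norm (q x - q y) \<longrightarrow>
      norm (r x - r y) = norm (p x - p y)} p q'"
proof -
  have fin: "finite V" by (rule three_tree_finite[OF T])
  have EV: "x \<in> V" "y \<in> V" if "{x, y} \<in> E" for x y
    using that three_tree_edges_subset[OF T] by auto
  obtain a where a: "a \<in> V" using three_tree_nonempty[OF T] by auto
  obtain N :: nat where N: "\<And>(r :: nat \<Rightarrow> real^3) (D :: real) x y. 0 \<le> D \<Longrightarrow>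
    (\<And>x y. {x, y} \<in> E \<Longrightarrow> norm (r x - r y) \<le> D) \<Longrightarrow> x \<in> V \<Longrightarrow> y \<in> V \<Longrightarrow> norm (r x - r y) \<le> N * D"
    using three_tree_diameter_bound[OF T] by blast
  define e where "e n = inverse (real (Suc n))" for n
  have e: "0 < e n" "e n \<le> 1" for n
    by (simp_all add: e_def field_simps)
  have e0: "e \<longlonglongrightarrow> 0"
    unfolding e_def by (rule LIMSEQ_inverse_real_of_nat)
  have approx: "\<exists>f. \<forall>n. noncollinear_on V (f n) \<and> (\<forall>x\<in>V. dist (f n x) (r x) < e n) \<and> (\<forall>x. x \<notin> V \<longrightarrow> f n x = 0)"
    for r :: "nat \<Rightarrow> real^3"
  proof (rule choice, rule allI)
    fix n
    obtain r' where r': "noncollinear_on V r'" "\<forall>x\<in>V. dist (r' x) (r x) < e n"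
      using noncollinear_on_dense[OF fin e(1)] by blast
    then show "\<exists>f. noncollinear_on V f \<and> (\<forall>x\<in>V. dist (f x) (r x) < e n) \<and> (\<forall>x. x \<notin> V \<longrightarrow> f x = 0)"
      by (intro exI[of _ "\<lambda>x. if x \<in> V then r' x else 0"]) (auto simp: noncollinear_on_def)
  qed
  obtain pn where pn: "\<And>n. noncollinear_on V (pn n)" "\<And>n x. x \<in> V \<Longrightarrow> dist (pn n x) (p x) < e n"
      "\<And>n x. x \<notin> V \<Longrightarrow> pn n x = 0"
    using approx[of p] by blast
  obtain qn where qn: "\<And>n. noncollinear_on V (qn n)" "\<And>n x. x \<in> V \<Longrightarrow> dist (qn n x) (q x) < e n"
    using approx[of q] by blast
  have lim: "(\<lambda>n. f n x) \<longlonglongrightarrow> r x" if "\<And>n. dist (f n x) (r x) < e n" for f and r :: "nat \<Rightarrow> real^3" and x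
    by (rule metric_tendsto_imp_tendsto[OF e0]) (use that e(1) in \<open>auto intro!: always_eventually less_imp_le simp: abs_of_pos\<close>)
  \<comment> \<open>Off \<open>V\<close> both sides vanish, so convergence holds in every
    coordinate, as the product topology demands.\<close>
  have pl: "(\<lambda>n. pn n x) \<longlonglongrightarrow> p x" for x
    using lim pn(2) pn(3)[of x] p0[of x] by (cases "x \<in> V") auto
  have ql: "(\<lambda>n. qn n x) \<longlonglongrightarrow> q x" if "x \<in> V" for x
    using lim qn(2) that by auto
  obtain B where B: "\<And>x. x \<in> V \<Longrightarrow> norm (p x) \<le> B" "\<And>x. x \<in> V \<Longrightarrow> norm (q x) \<le> B"
  proof
    let ?S = "\<lambda>r :: nat \<Rightarrow> real^3. \<Sum>x\<in>V. norm (r x)"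
    show "norm (p x) \<le> ?S p + ?S q" "norm (q x) \<le> ?S p + ?S q" if "x \<in> V" for x
      using member_le_sum[OF that, of "\<lambda>x. norm (p x)"] member_le_sum[OF that, of "\<lambda>x. norm (q x)"] fin
        sum_nonneg[of V "\<lambda>x. norm (p x)"] sum_nonneg[of V "\<lambda>x. norm (q x)"] by auto
  qed
  have B0: "0 \<le> B" using B(1)[OF a] norm_ge_zero order_trans by blast
  have near: "norm v \<le> B + 1" if "dist v w < e n" "norm w \<le> B" for v w :: "real^3" and n
    using that e(2)[of n] norm_triangle_ineq2[of v w] by (simp add: dist_norm)
  have nB: "norm (pn n x) \<le> B + 1" "norm (qn n x) \<le> B + 1" if "x \<in> V" for n x
    using near pn(2) qn(2) B that by blast+
  define D where "D = 2 * (B + 1)"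
  have D0: "0 \<le> D" using B0 by (simp add: D_def)
  have edge: "norm (pn n x - pn n y) \<le> D" "norm (qn n x - qn n y) \<le> D" if "{x, y} \<in> E" for n x y
    using nB[OF EV(1)[OF that], of n] nB[OF EV(2)[OF that], of n]
      norm_triangle_ineq4[of "pn n x" "pn n y"] norm_triangle_ineq4[of "qn n x" "qn n y"]
    by (auto simp: D_def)
  have "\<exists>g. \<forall>n. continuous_on {0..1} (g n) \<and> g n 0 = pn n \<and> (\<forall>t. g n t a = pn n a) \<and>
    (\<forall>t x. x \<notin> V \<longrightarrow> g n t x = 0) \<and> (\<forall>t\<in>{0..1}. \<forall>x y. {x, y} \<in> E \<longrightarrow>
      (norm (g n t x - g n t y))\<^sup>2 = (1 - t) * (norm (pn n x - pn n y))\<^sup>2 + t * (norm (qn n x - qn n y))\<^sup>2)"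
    by (rule choice, rule allI, rule three_tree_interpolation_path[OF T pn(1) qn(1) a pn(3)]) blast+
  then obtain g where g: "\<And>n. continuous_on {0..1} (g n)" "\<And>n. g n 0 = pn n" "\<And>n t. g n t a = pn n a"
    "\<And>n t x. x \<notin> V \<Longrightarrow> g n t x = 0"
    "\<And>n t x y. t \<in> {0..1} \<Longrightarrow> {x, y} \<in> E \<Longrightarrow>
      (norm (g n t x - g n t y))\<^sup>2 = (1 - t) * (norm (pn n x - pn n y))\<^sup>2 + t * (norm (qn n x - qn n y))\<^sup>2"
    by blast
  \<comment> \<open>At most \<open>N\<close> edges of length at most \<open>D\<close> lead to the
    anchor \<open>a\<close>, which stays within \<open>B + 1\<close> of the origin.\<close>
  define M where "M = N * D + (B + 1)"
  have M0: "0 \<le> M" using D0 B0 by (simp add: M_def)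
  have gD: "norm (g n t x - g n t y) \<le> D" if t: "t \<in> {0..1}" and xy: "{x, y} \<in> E" for n t x y
  proof -
    have "(norm (pn n x - pn n y))\<^sup>2 \<le> D\<^sup>2" "(norm (qn n x - qn n y))\<^sup>2 \<le> D\<^sup>2"
      using edge[OF xy] by (auto intro: power_mono)
    then have "(1 - t) * (norm (pn n x - pn n y))\<^sup>2 + t * (norm (qn n x - qn n y))\<^sup>2 \<le> D\<^sup>2"
      using t by (intro convex_bound_le) auto
    then show ?thesis
      using g(5)[OF that] D0 by (metis power2_le_imp_le)
  qed
  have gM: "norm (g n t x) \<le> M" if t: "t \<in> {0..1}" for n t x
  proof (cases "x \<in> V")
    case True
    have "norm (g n t x - g n t a) \<le> N * D"
      by (rule N[OF D0 _ True a]) (rule gD[OF t])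
    then show ?thesis
      using nB(1)[OF a, of n] norm_triangle_ineq[of "g n t x - g n t a" "g n t a"] by (simp add: M_def g(3))
  qed (simp add: g(4) M0)
  define C where "C = {r :: nat \<Rightarrow> real^3. \<forall>x. norm (r x) \<le> M}"
  \<comment> \<open>\<open>K\<close> fixes only the edges on which \<open>p\<close> and
    \<open>q\<close> agree; \<open>Q\<close> prescribes the lengths of \<open>q\<close> on all edges
    and is the target of the limit argument.\<close>
  define K where "K = {r :: nat \<Rightarrow> real^3. \<forall>x y. {x, y} \<in> E \<longrightarrow> norm (p x - p y) = norm (q x - q y) \<longrightarrow>
      norm (r x - r y) = norm (p x - p y)}"
  define Q where "Q = {r :: nat \<Rightarrow> real^3. \<forall>x y. {x, y} \<in> E \<longrightarrow> norm (r x - r y) = norm (q x - q y)}"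
  have cC: "compact C" unfolding C_def by (rule compact_bounded_functions)
  have clK: "closed K"
    unfolding K_def by (intro closed_Collect_all closed_Collect_imp closed_norm_diff_eq open_Collect_const)
  have clQ: "closed Q"
    unfolding Q_def by (intro closed_Collect_all closed_Collect_imp closed_norm_diff_eq open_Collect_const)
  have clC: "closed C"
    unfolding C_def by (intro closed_Collect_all closed_Collect_le continuous_intros continuous_on_product_coordinates)
  have "\<exists>b\<in>Q. connected_component (C \<inter> K) p b"
  proof (rule connected_component_limit[where S = "\<lambda>n. g n ` {0..1}" and x = "\<lambda>n. g n 0" and y = "\<lambda>n. g n 1"])
    show "g n ` {0..1} \<subseteq> C" for n
      using gM by (auto simp: C_def)
    show "connected (g n ` {0..1})" for n
      by (intro connected_continuous_image g) simp
    show "(\<lambda>n. g n 0) \<longlonglongrightarrow> p"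
      using pl by (simp add: g(2) tendsto_fun_iff)
  next
    fix z \<sigma> r assume \<sigma>: "strict_mono \<sigma>" and z: "\<And>n. z n \<in> g (\<sigma> n) ` {0..1}" and zr: "z \<longlonglongrightarrow> r"
    have "\<forall>n. \<exists>s. s \<in> {0..1} \<and> z n = g (\<sigma> n) s"
      using z by blast
    from choice[OF this] obtain s where s: "\<And>n. s n \<in> {0..1}" "\<And>n. z n = g (\<sigma> n) (s n)"
      by blast
    have "z n \<in> C" for n
      using s gM by (auto simp: C_def)
    then have "r \<in> C"
      using clC zr closed_sequentially by blast
    moreover have "norm (r x - r y) = norm (p x - p y)"
      if xy: "{x, y} \<in> E" and eq: "norm (p x - p y) = norm (q x - q y)" for x y
    proof -
      define lp where "lp n = (norm (pn (\<sigma> n) x - pn (\<sigma> n) y))\<^sup>2" for n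
      define lq where "lq n = (norm (qn (\<sigma> n) x - qn (\<sigma> n) y))\<^sup>2" for n
      have sub: "(\<lambda>n. f (\<sigma> n)) \<longlonglongrightarrow> l" if "f \<longlonglongrightarrow> l" for f :: "nat \<Rightarrow> real^3" and l
        using LIMSEQ_subseq_LIMSEQ[OF that \<sigma>] by (simp add: o_def)
      have lp: "lp \<longlonglongrightarrow> (norm (p x - p y))\<^sup>2"
        unfolding lp_def by (intro tendsto_intros sub pl)
      have lq: "lq \<longlonglongrightarrow> (norm (p x - p y))\<^sup>2"
        unfolding lq_def eq by (intro tendsto_intros sub ql EV[OF xy])
      \<comment> \<open>The times \<open>s n\<close> need not converge: being in the unit interval,
        they multiply a null sequence.\<close>
      have le: "norm (s n * (lq n - lp n)) \<le> norm (lq n - lp n)" for n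
        using s(1)[of n] by (simp add: abs_mult mult_left_le_one_le)
      have "(\<lambda>n. norm (lq n - lp n)) \<longlonglongrightarrow> 0"
        using tendsto_norm_zero[OF tendsto_diff[OF lq lp, simplified]] .
      then have "(\<lambda>n. s n * (lq n - lp n)) \<longlonglongrightarrow> 0"
        by (rule Lim_null_comparison[rotated]) (intro always_eventually allI le)
      from tendsto_add[OF lp this] have l1: "(\<lambda>n. lp n + s n * (lq n - lp n)) \<longlonglongrightarrow> (norm (p x - p y))\<^sup>2"
        by simp
      have eq1: "(norm (z n x - z n y))\<^sup>2 = lp n + s n * (lq n - lp n)" for n
        using g(5)[OF s(1) xy] by (simp add: s(2) lp_def lq_def algebra_simps)
      have l2: "(\<lambda>n. (norm (z n x - z n y))\<^sup>2) \<longlonglongrightarrow> (norm (r x - r y))\<^sup>2"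
        by (intro tendsto_intros zr[unfolded tendsto_fun_iff, rule_format])
      show ?thesis
        using LIMSEQ_unique[OF l2[unfolded eq1] l1] by simp
    qed
    ultimately show "r \<in> C \<inter> K" by (auto simp: K_def)
  next
    fix \<sigma> r assume \<sigma>: "strict_mono (\<sigma> :: nat \<Rightarrow> nat)" and r: "((\<lambda>n. g n 1) \<circ> \<sigma>) \<longlonglongrightarrow> r"
    have "norm (r x - r y) = norm (q x - q y)" if xy: "{x, y} \<in> E" for x y
    proof -
      have l1: "(\<lambda>n. (norm (((\<lambda>n. g n 1) \<circ> \<sigma>) n x - ((\<lambda>n. g n 1) \<circ> \<sigma>) n y))\<^sup>2) \<longlonglongrightarrow> (norm (r x - r y))\<^sup>2"
        by (intro tendsto_intros r[unfolded tendsto_fun_iff, rule_format])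
      \<comment> \<open>At time 1 the interpolated squared length is exactly that of
        \<open>qn\<close>.\<close>
      have eq1: "(norm (((\<lambda>n. g n 1) \<circ> \<sigma>) n x - ((\<lambda>n. g n 1) \<circ> \<sigma>) n y))\<^sup>2
          = (norm (qn (\<sigma> n) x - qn (\<sigma> n) y))\<^sup>2" for n
        using g(5)[OF _ xy, of 1] by simp
      have l2: "(\<lambda>n. (norm (qn (\<sigma> n) x - qn (\<sigma> n) y))\<^sup>2) \<longlonglongrightarrow> (norm (q x - q y))\<^sup>2"
        using LIMSEQ_subseq_LIMSEQ[OF ql \<sigma>] EV[OF xy] by (intro tendsto_intros) (auto simp: o_def)
      show ?thesis
        using LIMSEQ_unique[OF l1[unfolded eq1] l2] by simp
    qed
    then show "r \<in> Q" by (simp add: Q_def)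
  qed (auto simp: cC clK clQ clC)
  then obtain b where "b \<in> Q" "connected_component (C \<inter> K) p b" by blast
  then show ?thesis
    using connected_component_of_subset[of "C \<inter> K" p b K] by (auto simp: Q_def K_def)
qed

section \<open>Transport between the graph and the 3-tree containing it\<close>

theorem mainTheorem5:
  fixes V :: "'a set" and E :: "'a set set" and F :: "('a \<times> 'a) list"
  assumes "simple_graph V E"
    and "nonedges V E F"
    and "partial_three_tree V (graph_union E F)"
  shows "covering_map_property3 V E F"
  unfolding covering_map_property3_def
proof (intro allI impI ballI)
  fix l p assume p: "p \<in> config3 V E l"
  let ?C = "config3 V E l"
  obtain TV TE f where T: "three_tree TV TE" "inj_on f V" "f ` V \<subseteq> TV"
      "\<And>e. e \<in> graph_union E F \<Longrightarrow> f ` e \<in> TE"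
    using assms(3) unfolding partial_three_tree_def by blast
  \<comment> \<open>Tree vertices outside the image of \<open>f\<close> are placed at 0; beyond
    \<open>TV\<close> this is the normalization assumed in
    \<open>three_tree_component_reaches\<close>.\<close>
  define push where "push r i = (if i \<in> f ` V then r (the_inv_into V f i) else 0)" for r :: "'a \<Rightarrow> real^3" and i
  define pull where "pull r x = (if x \<in> V then r (f x) else 0)" for r :: "nat \<Rightarrow> real^3" and x
  have push: "push r (f x) = r x" if "x \<in> V" for r x
    using that T(2) by (simp add: push_def the_inv_into_f_f)
  have pull: "pull r x = r (f x)" if "x \<in> V" for r x
    using that by (simp add: pull_def)
  have edge: "x \<in> V" "y \<in> V" "{f x, f y} \<in> TE" if "{x, y} \<in> E" for x y
    using that assms(1) T(4)[of "{x, y}"] by (auto simp: simple_graph_def graph_union_def)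
  have nonedge: "x \<in> V" "y \<in> V" "{f x, f y} \<in> TE" if "(x, y) \<in> set F" for x y
    using that assms(2) T(4)[of "{x, y}"] by (force simp: nonedges_def graph_union_def)+
  have "cayley_map F q \<in> cayley_map F ` connected_component_set ?C p" if q: "q \<in> ?C" for q
  proof -
    \<comment> \<open>Images of edges in \<open>E\<close> are among the constrained ones, since
      \<open>p\<close> and \<open>q\<close> both realize \<open>l\<close> there.\<close>
    let ?K = "{r. \<forall>x y. {x, y} \<in> TE \<longrightarrow> norm (push p x - push p y) = norm (push q x - push q y) \<longrightarrow>
      norm (r x - r y) = norm (push p x - push p y)}"
    have "push p x = 0" if "x \<notin> TV" for x
      using that T(3) by (auto simp: push_def)
    then obtain q' where q': "\<And>x y. {x, y} \<in> TE \<Longrightarrow> norm (q' x - q' y) = norm (push q x - push q y)"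
        "connected_component ?K (push p) q'"
      using three_tree_component_reaches[OF T(1), of "push p" "push q"] by blast
    then obtain S where S: "connected S" "S \<subseteq> ?K" "push p \<in> S" "q' \<in> S"
      unfolding connected_component_def by blast
    \<comment> \<open>\<open>pull\<close> carries the connected set \<open>S\<close> into the
      configuration space, so the component of \<open>p\<close> contains
      \<open>pull q'\<close>.\<close>
    have cont: "continuous_on S pull"
    proof (rule continuous_on_coordinatewise_then_product)
      show "continuous_on S (\<lambda>r. pull r x)" for x
        by (cases "x \<in> V")
          (auto simp: pull_def intro: continuous_on_subset[OF continuous_on_product_coordinates])
    qed
    have "pull r \<in> ?C" if "r \<in> S" for r
      unfolding config3_def
    proof (intro CollectI conjI allI impI ballI)
      show "pull r x = 0" if "x \<notin> V" for x
        using that by (simp add: pull_def)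
      fix e x y assume e: "e \<in> E" "e = {x, y}"
      then have xy: "x \<in> V" "y \<in> V" "{f x, f y} \<in> TE"
        using edge by auto
      have "(norm (p x - p y))\<^sup>2 = l e" "(norm (q x - q y))\<^sup>2 = l e"
        using p q e by (auto simp: config3_def)
      moreover from this have "norm (p x - p y) = norm (q x - q y)"
        by (metis norm_ge_zero power2_eq_iff_nonneg)
      moreover have "r \<in> ?K" using that S(2) by blast
      ultimately show "(norm (pull r x - pull r y))\<^sup>2 = l e"
        using xy by (simp add: pull push)
    qed
    then have "connected (pull ` S)" "pull ` S \<subseteq> ?C"
      using connected_continuous_image[OF cont S(1)] by auto
    moreover have "pull (push p) = p"
      using p by (auto simp: pull_def push config3_def)
    ultimately have "connected_component ?C p (pull q')"
      unfolding connected_component_def using S(3,4) by (metis imageI)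
    \<comment> \<open>The pairs of \<open>F\<close> map to tree edges, on which \<open>q'\<close>
      has the lengths of \<open>q\<close>, whether or not \<open>p\<close> has them too.\<close>
    moreover have "cayley_map F (pull q') = cayley_map F q"
      using nonedge q'(1) by (auto simp: cayley_map_def pull push)
    ultimately show ?thesis
      by (metis imageI mem_Collect_eq)
  qed
  \<comment> \<open>The inclusion just proved is the substantial one; the other holds because a
    component is a subset of the space.\<close>
  then show "cayley_map F ` connected_component_set ?C p = Omega3 V E l F"
    unfolding Omega3_def using connected_component_subset by blast
qed

end
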